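(* Let $X$ be any random vector taking values in $\mathbb{R}^n$. Let $T \subset \mathbb{R}^n$ be any nonempty origin-symmetric set with $0 \notin T$ and let $u>0$ be any number. Assume that $$r > 2u \cdot \bar{w}_X(T).$$ Then there exists a Borel set $A \subset \mathbb{R}^n$ such that $$\mathbb{P}\{X \in A\} > 1-\frac1u \quad \text{and} \quad \mathbb{P}\{X \in A-rT\} < \frac1u.$$
   Context: A set $T\subset\mathbb{R}^n$ is origin-symmetric if $T=-T$. For a random vector $X$ in $\mathbb{R}^n$ and a nonempty set $T \subset \mathbb{R}^n\setminus\{0\}$, the scaled $X$-width of $T$ is $$\bar{w}_X(T) = \mathbb{E} \sup_{t \in T} \left\langle X, \frac{t}{\|t\|_2^2}\right\rangle$$ (for origin-symmetric $T$ the supremum is nonnegative, so this is a well-defined element of $[0,\infty]$). For $A,T\subset\mathbb{R}^n$ and $r\in\mathbb{R}$, $A-rT = \{a-rt : a\in A,\ t\in T\}$. If $A-rT$ is not measurable, $\mathbb{P}\{X\in A-rT\}$ is understood as outer probability. *)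

theory Defs
  imports "HOL-Probability.Probability"
begin

definition origin_symmetric :: "'a::real_vector set \<Rightarrow> bool" where
  "origin_symmetric T \<longleftrightarrow> T = uminus ` T"

text \<open>
  The expectation of an extended-real-valued random variable: the integral of its positive part
  minus that of its negative part (\<^const>\<open>e2ennreal\<close> sends negative values to 0). If both are
  infinite, the value is a convention (\<^term>\<open>\<infinity> - \<infinity> = (\<infinity>::ereal)\<close>).
\<close>

definition ereal_expectation :: "'w measure \<Rightarrow> ('w \<Rightarrow> ereal) \<Rightarrow> ereal" where
  "ereal_expectation M Y =
     enn2ereal (\<integral>\<^sup>+ \<omega>. e2ennreal (Y \<omega>) \<partial>M) - enn2ereal (\<integral>\<^sup>+ \<omega>. e2ennreal (- Y \<omega>) \<partial>M)"

text \<open>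
  The supremum, taken in \<^typ>\<open>ereal\<close>, is Borel measurable in \<open>X \<omega>\<close> even for uncountable \<open>T\<close>,
  since it is lower semicontinuous. For nonempty origin-symmetric \<open>T\<close> it is nonnegative, so the
  negative part in \<^const>\<open>ereal_expectation\<close> vanishes.
\<close>

definition scaled_width ::
    "'w measure \<Rightarrow> ('w \<Rightarrow> real ^ 'n) \<Rightarrow> (real ^ 'n) set \<Rightarrow> ereal" where
  "scaled_width M X T =
     ereal_expectation M (\<lambda>\<omega>. SUP t\<in>T. ereal (X \<omega> \<bullet> (t /\<^sub>R (norm t)\<^sup>2)))"

definition minus_scaled :: "'a::real_vector set \<Rightarrow> real \<Rightarrow> 'a set \<Rightarrow> 'a set" where
  "minus_scaled A r T = {a - r *\<^sub>R t | a t. a \<in> A \<and> t \<in> T}"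

text \<open>
  \<open>minus_scaled A r T\<close> need not be Borel, even for Borel \<open>A\<close>. The probability that \<open>X\<close> lies in it
  is therefore expressed by \<^const>\<open>outer_measure_of\<close> \<open>M\<close>, which is \<^term>\<open>emeasure M\<close> on events.
\<close>

end

(* Let f x = sup {<x, t/|t|^2> | t in T}, so that the scaled width is E f(X), and take
   A = {f <= r/2}. If x = a - r t with a in A and t in T, then testing f x against -t gives
   f x >= r - <a, t/|t|^2> >= r/2. Hence both the complement of A and A - r T lie in
   {f >= r/2}, which by Markov's inequality has probability at most 2 E f(X) / r < 1/u. *)
theory Submission
  imports Defs
begin

text \<open>The support function of the image of \<open>T\<close> under inversion in the unit
  sphere. It is \<open>ereal\<close>-valued because this image may be unbounded, namely when
  \<open>T\<close> accumulates at 0.\<close>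

definition polar_sup :: "'a::real_inner set \<Rightarrow> 'a \<Rightarrow> ereal" where
  "polar_sup T x = (SUP t\<in>T. ereal (x \<bullet> (t /\<^sub>R (norm t)\<^sup>2)))"

lemma origin_symmetric_uminus:
  assumes "origin_symmetric T" "t \<in> T"
  shows "- t \<in> T"
  using assms unfolding origin_symmetric_def by blast

lemma polar_sup_upper: "t \<in> T \<Longrightarrow> ereal (x \<bullet> (t /\<^sub>R (norm t)\<^sup>2)) \<le> polar_sup T x"
  unfolding polar_sup_def by (rule SUP_upper)

text \<open>The values at \<open>t\<close> and \<open>- t\<close> are opposite numbers, so one of
  them is nonnegative.\<close>

lemma polar_sup_nonneg:
  assumes "T \<noteq> {}" "origin_symmetric T"
  shows "0 \<le> polar_sup T x"
proof -
  obtain t where "t \<in> T" using assms(1) by blast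
  have "0 \<le> x \<bullet> (t /\<^sub>R (norm t)\<^sup>2) \<or> 0 \<le> x \<bullet> (- t /\<^sub>R (norm (- t))\<^sup>2)"
    by (simp add: inner_minus_right) linarith
  then show ?thesis
    using polar_sup_upper[OF \<open>t \<in> T\<close>, of x]
      polar_sup_upper[OF origin_symmetric_uminus[OF assms(2) \<open>t \<in> T\<close>], of x]
    by (metis ereal_less_eq(5) order_trans)
qed

text \<open>A supremum exceeds \<open>y\<close> iff one of its members does, so the set is a union
  of open sets. This lower semicontinuity yields Borel measurability even for uncountable
  \<open>T\<close>.\<close>

lemma open_polar_sup_greater: "open {x. y < polar_sup T x}"
proof -
  have "{x. y < polar_sup T x} = (\<Union>t\<in>T. {x. y < ereal (x \<bullet> (t /\<^sub>R (norm t)\<^sup>2))})"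
    by (auto simp: polar_sup_def less_SUP_iff)
  then show ?thesis
    by (auto intro!: open_UN open_Collect_less continuous_intros)
qed

lemma borel_measurable_polar_sup [measurable]: "polar_sup T \<in> borel_measurable borel"
  by (intro borel_measurableI_greater) (simp add: open_polar_sup_greater)

lemma polar_sup_minus_scaled:
  assumes "origin_symmetric T" "0 \<notin> T"
    and "x \<in> minus_scaled {a. polar_sup T a \<le> ereal c} r T"
  shows "ereal (r - c) \<le> polar_sup T x"
proof -
  obtain a t where a: "polar_sup T a \<le> ereal c" and t: "t \<in> T" and x: "x = a - r *\<^sub>R t"
    using assms(3) unfolding minus_scaled_def by blast
  have "t \<noteq> 0" using assms(2) t by blast
  \<comment> \<open>The coefficient of \<open>r\<close> is the inner product of \<open>t\<close>
    with \<open>t /\<^sub>R (norm t)\<^sup>2\<close>, which is 1 as \<open>t\<close> is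
    nonzero.\<close>
  then have "x \<bullet> (- t /\<^sub>R (norm (- t))\<^sup>2) = r - a \<bullet> (t /\<^sub>R (norm t)\<^sup>2)"
    by (simp add: x inner_diff_left power2_norm_eq_inner algebra_simps)
  moreover have "a \<bullet> (t /\<^sub>R (norm t)\<^sup>2) \<le> c"
    using polar_sup_upper[OF t, of a] a by (metis ereal_less_eq(3) order_trans)
  ultimately show ?thesis
    using polar_sup_upper[OF origin_symmetric_uminus[OF assms(1) t], of x]
    by (metis diff_left_mono ereal_less_eq(3) order_trans)
qed

text \<open>By symmetry the integrand is nonnegative, so the negative part of the expectation
  vanishes.\<close>

lemma scaled_width_eq_nn_integral:
  assumes "T \<noteq> {}" "origin_symmetric T"
  shows "scaled_width M X T = enn2ereal (\<integral>\<^sup>+ \<omega>. e2ennreal (polar_sup T (X \<omega>)) \<partial>M)"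
proof -
  have "e2ennreal (- polar_sup T (X \<omega>)) = 0" for \<omega>
    using polar_sup_nonneg[OF assms] by (intro e2ennreal_neg) simp
  then show ?thesis
    unfolding scaled_width_def ereal_expectation_def polar_sup_def[symmetric]
    by (simp add: zero_ennreal.rep_eq)
qed

theorem theorem4p1:
  fixes M :: "'w measure"
    and X :: "'w \<Rightarrow> real ^ 'n"
    and T :: "(real ^ 'n) set"
    and u r :: real
  assumes "prob_space M"
    and "X \<in> borel_measurable M"
    and "T \<noteq> {}"
    and "origin_symmetric T"
    and "0 \<notin> T"
    and "u > 0"
    and "ereal r > 2 * ereal u * scaled_width M X T"
  shows "\<exists>A \<in> sets (borel :: (real ^ 'n) measure).
           \<P>(\<omega> in M. X \<omega> \<in> A) > 1 - 1 / u \<and>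
           outer_measure_of M {\<omega> \<in> space M. X \<omega> \<in> minus_scaled A r T} < ennreal (1 / u)"
proof -
  interpret prob_space M by fact
  note [measurable] = assms(2)
  define W where "W = (\<integral>\<^sup>+ \<omega>. e2ennreal (polar_sup T (X \<omega>)) \<partial>M)"
  have r_gt: "ereal r > 2 * ereal u * enn2ereal W"
    using assms(7) by (simp add: W_def scaled_width_eq_nn_integral[OF assms(3,4)])
  \<comment> \<open>As \<open>u > 0\<close>, an infinite \<open>W\<close> would make the right-hand
    side infinite, and no real \<open>r\<close> exceeds that.\<close>
  then have "W \<noteq> \<top>"
    using assms(6) by (auto simp: top_ennreal.rep_eq)
  then obtain w where W: "W = ennreal w" and w: "0 \<le> w"
    by (cases W) auto
  have rw: "r > 2 * u * w"
    using r_gt w by (simp add: W enn2ereal_ennreal)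
  then have r: "r > 0"
    using w assms(6) by (smt (verit) mult_nonneg_nonneg)
  \<comment> \<open>The threshold \<open>c = r / 2\<close> solves \<open>r - c = c\<close>, so the
    same event \<open>B\<close> controls both probabilities.\<close>
  define A where "A = {a. polar_sup T a \<le> ereal (r / 2)}"
  have [measurable]: "A \<in> sets borel"
    unfolding A_def by measurable
  define B where "B = {\<omega> \<in> space M. ereal (r / 2) \<le> polar_sup T (X \<omega>)}"
  have [measurable]: "B \<in> sets M"
    unfolding B_def by measurable
  \<comment> \<open>Markov's inequality: \<open>polar_sup T (X \<omega>)\<close> is at least
    \<open>r / 2\<close> on \<open>B\<close> and nonnegative elsewhere.\<close>
  have "ennreal (r / 2) * emeasure M B = (\<integral>\<^sup>+ \<omega>. ennreal (r / 2) * indicator B \<omega> \<partial>M)"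
    by (simp add: nn_integral_cmult_indicator)
  also have "\<dots> \<le> W"
    unfolding W_def
    by (intro nn_integral_mono)
      (auto simp: B_def indicator_def e2ennreal_ereal[symmetric] intro!: e2ennreal_mono
        simp del: e2ennreal_ereal)
  finally have "r / 2 * prob B \<le> w"
    using r w by (simp add: W emeasure_eq_measure flip: ennreal_mult)
  \<comment> \<open>Together with \<open>2 * u * w < r\<close> this gives
    \<open>r * (u * prob B) < r\<close>; cancelling \<open>r > 0\<close> keeps the inequality
    strict.\<close>
  then have "u * (r * prob B) \<le> u * (2 * w)"
    using assms(6) by (intro mult_left_mono) simp_all
  then have "r * (u * prob B) < r"
    using rw by (simp add: mult.assoc mult.left_commute)
  then have B: "prob B < 1 / u"
    using r assms(6) by (simp add: field_simps)
  \<comment> \<open>Outside \<open>B\<close> the supremum is below \<open>r / 2\<close>, which puts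
    \<open>X \<omega>\<close> in \<open>A\<close>.\<close>
  have "prob (space M - B) \<le> \<P>(\<omega> in M. X \<omega> \<in> A)"
    by (intro finite_measure_mono) (auto simp: A_def B_def)
  then have "\<P>(\<omega> in M. X \<omega> \<in> A) > 1 - 1 / u"
    using B by (simp add: prob_compl)
  have "{\<omega> \<in> space M. X \<omega> \<in> minus_scaled A r T} \<subseteq> B"
    using polar_sup_minus_scaled[OF assms(4,5), of _ "r / 2" r] by (auto simp: A_def B_def)
  \<comment> \<open>\<open>B\<close> is an event, so its outer measure is its probability, whether
    or not the smaller set is measurable.\<close>
  then have "outer_measure_of M {\<omega> \<in> space M. X \<omega> \<in> minus_scaled A r T} \<le> emeasure M B"
    using outer_measure_of_mono[of _ B M] by simp
  also have "emeasure M B < ennreal (1 / u)"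
    using B by (simp add: emeasure_eq_measure ennreal_less_iff)
  finally show ?thesis
    using \<open>A \<in> sets borel\<close> \<open>\<P>(\<omega> in M. X \<omega> \<in> A) > 1 - 1 / u\<close> by blast
qed

end
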